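(* Let $q\le1$ and let $$S_{hyp}(\gamma)=\sum_{(jk)}\big(F(\gamma_j-\gamma_k)+F(\gamma_j+\gamma_k)\big)+\sum_j\Phi_j\gamma_j,$$ where the first sum is over all edges (pairs of neighboring vertices) of $G$, the second over all vertices of $G$, and $\Phi_j\in\mathbb{R}$ are prescribed parameters. The functional $S_{hyp}$ is convex, and its second derivative is the quadratic form $$D^2S_{hyp}=\frac12\sum_{(j,k)}\Big[\big(\operatorname{dn}(\gamma_j-\gamma_k)+q\operatorname{cn}(\gamma_j-\gamma_k)\big)(d\gamma_j-d\gamma_k)^2+\big(\operatorname{dn}(\gamma_j+\gamma_k)+q\operatorname{cn}(\gamma_j+\gamma_k)\big)(d\gamma_j+d\gamma_k)^2\Big],$$ where the sum is taken over pairs of neighboring rings (i.e. neighboring vertices of $G$).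
   Context: $\Pi\subset\mathbb{Z}^2$ is a simply connected cell complex defined by a subset of elementary squares of the $\mathbb{Z}^2$ lattice (the main example being a combinatorial rectangle $1\le m\le M$, $1\le n\le N$), identified with its vertex set, and $G=\{(m,n)\in\Pi: m+n\text{ even}\}$. Vertices $(m,n)$ and $(m\pm1,n\pm1)$ of $G$ are called neighboring. The variables $\gamma_j$ are real, one for each vertex of $G$. $\operatorname{sn},\operatorname{cn},\operatorname{dn}$ are the Jacobi elliptic functions of modulus $q$, and $K,K'$ are the complete elliptic integrals of the first kind of modulus $q$ and of the complementary modulus; for $q=1$ one has $\operatorname{sn}=\tanh$, $\operatorname{cn}=\operatorname{dn}=1/\cosh$, $K'=\pi/2$, $K=\infty$. $g:\mathbb{R}\to\mathbb{R}$ is the smooth function $g(x)=\frac{\pi}{2}-\arg\operatorname{sn}\big(\frac{x+iK'}{2},q\big)$ with the continuous branch normalized by $g(0)=0$, and $F(x)=\int_0^xg(u)\,du$.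
   Formalization: The condition q ≤ 1 is read as 0 < q ≤ 1: at q = 0 the period K' is infinite and g is undefined, and for negative q the functions sn, cn, dn, K' depend only on q², so the formula with q·cn fails. *)

theory Defs
  imports "HOL-Complex_Analysis.Complex_Analysis"
begin

text \<open>The elliptic integrals and functions are parametrised by the modulus (not the parameter \<open>m = q\<^sup>2\<close>),
  and are meant for \<open>0 \<le> q \<le> 1\<close>.\<close>

definition elliptic_F :: "real \<Rightarrow> real \<Rightarrow> real" where
  "elliptic_F q \<phi> = (LBINT \<theta>=0..\<phi>. 1 / sqrt (1 - q\<^sup>2 * (sin \<theta>)\<^sup>2))"

text \<open>For \<open>q = 1\<close> the integral defining \<open>elliptic_K\<close> diverges (and so the term has an irrelevant
  default value); \<open>elliptic_K'\<close> is meaningful for \<open>0 < q \<le> 1\<close>.\<close>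

definition elliptic_K :: "real \<Rightarrow> real" where
  "elliptic_K q = elliptic_F q (pi / 2)"

definition elliptic_K' :: "real \<Rightarrow> real" where
  "elliptic_K' q = elliptic_K (sqrt (1 - q\<^sup>2))"

text \<open>The amplitude is the inverse of the elliptic integral of the first kind. For \<open>q < 1\<close> that
  integral is a bijection of the reals. For \<open>q = 1\<close> it converges only on the open interval
  from \<open>-pi/2\<close> to \<open>pi/2\<close>, which it maps bijectively onto the reals.\<close>

definition jacobi_am :: "real \<Rightarrow> real \<Rightarrow> real" where
  "jacobi_am q u = (THE \<phi>. (q = 1 \<longrightarrow> \<bar>\<phi>\<bar> < pi / 2) \<and> elliptic_F q \<phi> = u)"

definition jacobi_sn :: "real \<Rightarrow> real \<Rightarrow> real" where
  "jacobi_sn q u = sin (jacobi_am q u)"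

definition jacobi_cn :: "real \<Rightarrow> real \<Rightarrow> real" where
  "jacobi_cn q u = cos (jacobi_am q u)"

definition jacobi_dn :: "real \<Rightarrow> real \<Rightarrow> real" where
  "jacobi_dn q u = sqrt (1 - q\<^sup>2 * (jacobi_sn q u)\<^sup>2)"

text \<open>The function \<open>sn\<close> of a complex argument: the meromorphic function on the whole plane that
  extends the real one (by convention it is given the value 0 at its poles).\<close>

definition jacobi_sn_complex :: "real \<Rightarrow> complex \<Rightarrow> complex" where
  "jacobi_sn_complex q =
     (THE f. f nicely_meromorphic_on UNIV \<and>
             (\<forall>u::real. f (complex_of_real u) = complex_of_real (jacobi_sn q u)))"


text \<open>\<open>g(x) = pi/2 - arg sn((x + i K')/2, q)\<close> with the continuous branch of the argument for
  which \<open>g(0) = 0\<close>: the condition below says that \<open>pi/2 - g(x)\<close> is one of the values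
  of that argument. Since \<open>sn\<close> has neither poles nor
  zeros on the line in question, this determines \<open>g\<close>.\<close>

definition ring_g :: "real \<Rightarrow> real \<Rightarrow> real" where
  "ring_g q =
     (THE g. continuous_on UNIV g \<and> g 0 = 0 \<and>
        (\<forall>x. is_Arg (jacobi_sn_complex q ((complex_of_real x + \<i> * complex_of_real (elliptic_K' q)) / 2))
                    (pi / 2 - g x)))"

definition ring_F :: "real \<Rightarrow> real \<Rightarrow> real" where
  "ring_F q x = (LBINT u=0..x. ring_g q u)"


text \<open>A cell complex made of elementary squares of the lattice is given by the set \<open>Q\<close> of the lower
  left corners of its squares.\<close>

definition square_region :: "(int \<times> int) set \<Rightarrow> (real \<times> real) set" where
  "square_region Q =
     (\<Union>(m, n)\<in>Q. {real_of_int m..real_of_int m + 1} \<times> {real_of_int n..real_of_int n + 1})"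

definition simply_connected_square_complex :: "(int \<times> int) set \<Rightarrow> bool" where
  "simply_connected_square_complex Q \<longleftrightarrow> finite Q \<and> simply_connected (square_region Q)"

definition square_vertices :: "(int \<times> int) set \<Rightarrow> (int \<times> int) set" where
  "square_vertices Q = (\<Union>(m, n)\<in>Q. {m, m + 1} \<times> {n, n + 1})"

definition even_vertices :: "(int \<times> int) set \<Rightarrow> (int \<times> int) set" where
  "even_vertices Q = {(m, n) \<in> square_vertices Q. even (m + n)}"

definition neighboring :: "int \<times> int \<Rightarrow> int \<times> int \<Rightarrow> bool" where
  "neighboring p r \<longleftrightarrow> \<bar>fst p - fst r\<bar> = 1 \<and> \<bar>snd p - snd r\<bar> = 1"

text \<open>The vertices of \<open>G\<close> are labelled by a finite type through a bijection \<open>pos\<close>, so that the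
  variables form a vector in \<open>real ^ 'v\<close>. Every edge (unordered pair of neighboring vertices)
  is listed exactly once, oriented from left to right; as \<open>F\<close>, \<open>cn\<close> and \<open>dn\<close> are even
  functions, the orientation does not affect the sums below.\<close>

definition ring_edges :: "('v \<Rightarrow> int \<times> int) \<Rightarrow> ('v \<times> 'v) set" where
  "ring_edges pos = {(j, k). neighboring (pos j) (pos k) \<and> fst (pos j) < fst (pos k)}"


definition S_hyp ::
  "real \<Rightarrow> ('v::finite \<Rightarrow> int \<times> int) \<Rightarrow> ('v \<Rightarrow> real) \<Rightarrow> real ^ 'v \<Rightarrow> real" where
  "S_hyp q pos \<Phi> \<gamma> =
     (\<Sum>(j, k)\<in>ring_edges pos. ring_F q (\<gamma> $ j - \<gamma> $ k) + ring_F q (\<gamma> $ j + \<gamma> $ k))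
     + (\<Sum>j\<in>UNIV. \<Phi> j * \<gamma> $ j)"

text \<open>Second Frechet derivative at a point, as a map into the space of bounded linear forms.\<close>

definition has_second_derivative ::
  "('a::real_normed_vector \<Rightarrow> real) \<Rightarrow> ('a \<Rightarrow> 'a \<Rightarrow>\<^sub>L real) \<Rightarrow> 'a \<Rightarrow> bool" where
  "has_second_derivative f D x \<longleftrightarrow>
     (\<exists>f' :: 'a \<Rightarrow> 'a \<Rightarrow>\<^sub>L real.
        (\<forall>\<^sub>F y in nhds x. (f has_derivative blinfun_apply (f' y)) (at y)) \<and>
        (f' has_derivative D) (at x))"

end

theory Submission
  imports Defs
begin

text \<open>
  The functional is a sum of functions \<open>F\<close> of one variable composed with the linear forms
  \<open>\<gamma>\<^sub>j - \<gamma>\<^sub>k\<close> and \<open>\<gamma>\<^sub>j + \<gamma>\<^sub>k\<close>, plus a linear form. Both claims therefore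
  reduce to the one-variable identity
  \<open>F''(x) = g'(x) = (dn x + q cn x) / 2\<close> (\<open>DERIV_ring_g\<close>): the second derivative follows from the chain
  rule, and convexity from \<open>dn\<^sup>2 - q\<^sup>2 cn\<^sup>2 = 1 - q\<^sup>2 \<ge> 0\<close> together with \<open>dn > 0\<close>.

  Since \<open>g\<close> is defined by the argument of \<open>sn\<close> on the line \<open>Im z = K'/2\<close>, the values of the meromorphic
  function \<open>sn\<close> there are needed. The addition theorem and Jacobi's imaginary transformation suggest
  what \<open>sn (x + i y)\<close> has to be, namely
  \<open>(s d\<^sub>1 + i c d s\<^sub>1 c\<^sub>1) / (c\<^sub>1\<^sup>2 + q\<^sup>2 s\<^sup>2 s\<^sub>1\<^sup>2)\<close>, where \<open>s, c, d\<close> are the Jacobi functions of \<open>x\<close>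
  of modulus \<open>q\<close> and \<open>s\<^sub>1, c\<^sub>1, d\<^sub>1\<close> those of \<open>y\<close> of the complementary modulus. Instead of
  proving an addition theorem, one takes this formula as a definition. The differential
  equations of the real functions turn the Cauchy-Riemann equations into polynomial identities, both for this
  function and for its reciprocal \<open>(s d\<^sub>1 - i c d s\<^sub>1 c\<^sub>1) / (s\<^sub>1\<^sup>2 + s\<^sup>2 c\<^sub>1\<^sup>2)\<close>. The two denominators have
  no common zero, so the formula is meromorphic on the plane, and by the identity theorem
  it is \<open>sn\<close> (\<open>jacobi_sn_complex_eq\<close>).

  At \<open>y = K'/2\<close> the values \<open>s\<^sub>1, c\<^sub>1, d\<^sub>1\<close> are algebraic in \<open>q\<close> (\<open>jacobi_half_period\<close>), and the formula gives
  \<open>sn ((x + i K')/2) = i exp (- i \<theta>) / sqrt q\<close> with \<open>sin \<theta> = (1 + q) s / (1 + q s\<^sup>2)\<close> and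
  \<open>cos \<theta> = c d / (1 + q s\<^sup>2)\<close>, where \<open>s, c, d\<close> are now taken at \<open>x/2\<close>. The derivative of \<open>\<theta>\<close> is
  \<open>(1 + q) (1 - q s\<^sup>2) / (2 (1 + q s\<^sup>2))\<close>, and a duplication formula (\<open>jacobi_dn_cn_half_argument\<close>) identifies it with
  \<open>(dn x + q cn x) / 2\<close>. Continuity and \<open>g 0 = 0\<close> leave no choice for the branch, so \<open>g = \<theta>\<close>.\<close>

text \<open>In what follows \<open>$\<close> denotes the components of vectors, not the coefficients of power series.\<close>

no_notation fps_nth (infixl "$" 75)

section \<open>The real Jacobi functions and their differential equations\<close>

lemma interval_integral_has_real_derivative:
  fixes f :: "real \<Rightarrow> real"
  assumes cont: "continuous_on {a<..<b} f" and c: "a < c" "c < b" and x: "a < x" "x < b"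
  shows "((\<lambda>u. LBINT t=c..u. f t) has_real_derivative f x) (at x)"
proof -
  define a' where "a' = (a + min c x) / 2"
  define b' where "b' = (b + max c x) / 2"
  have *: "a < a'" "a' < c" "a' < x" "c < b'" "x < b'" "b' < b"
    using c x by (auto simp: a'_def b'_def min_def max_def)
  have "((\<lambda>u. LBINT t=c..u. f t) has_vector_derivative f x) (at x within {a'..b'})"
    by (rule interval_integral_FTC2) (use * in \<open>auto intro: continuous_on_subset[OF cont]\<close>)
  moreover have "at x within {a'..b'} = at x"
    by (rule at_within_interior) (use * in \<open>auto simp: interior_atLeastAtMost_real\<close>)
  ultimately show ?thesis
    by (simp add: has_real_derivative_iff_has_vector_derivative)
qed

lemma modulus_square_le_1: "0 \<le> (k::real) \<Longrightarrow> k \<le> 1 \<Longrightarrow> k\<^sup>2 \<le> 1"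
  by (simp add: power_le_one)

text \<open>The amplitudes at which the elliptic integral converges. For the limiting modulus \<open>1\<close> this is
  the interval between the singularities \<open>\<plusminus>\<pi>/2\<close> of the integrand; with this set the statements below cover all moduli
  at once.\<close>
definition amplitude_domain :: "real \<Rightarrow> real set" where
  "amplitude_domain k = {\<phi>. k = 1 \<longrightarrow> \<bar>\<phi>\<bar> < pi / 2}"

lemma elliptic_integrand_pos:
  assumes "0 \<le> k" "k \<le> 1" "\<phi> \<in> amplitude_domain k"
  shows "0 < 1 - k\<^sup>2 * (sin \<phi>)\<^sup>2"
proof (cases "k = 1")
  case True
  hence "cos \<phi> > 0" using assms by (intro cos_gt_zero_pi) (auto simp: amplitude_domain_def)
  thus ?thesis using True by (simp add: sin_squared_eq)
next
  case False
  hence "k\<^sup>2 < 1" using assms by (simp add: power_less_one_iff abs_square_less_1)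
  moreover have "k\<^sup>2 * (sin \<phi>)\<^sup>2 \<le> k\<^sup>2 * 1" by (intro mult_left_mono) (auto simp: abs_square_le_1)
  ultimately show ?thesis by linarith
qed

lemma DERIV_elliptic_F:
  assumes k: "0 \<le> k" "k \<le> 1" and phi: "\<phi> \<in> amplitude_domain k"
  shows "(elliptic_F k has_real_derivative 1 / sqrt (1 - k\<^sup>2 * (sin \<phi>)\<^sup>2)) (at \<phi>)"
proof -
  define r where "r = (if k = 1 then pi / 2 else \<bar>\<phi>\<bar> + 1)"
  have r: "r > 0" "- r < \<phi>" "\<phi> < r" using phi by (auto simp: r_def amplitude_domain_def)
  have "t \<in> amplitude_domain k" if "t \<in> {-r<..<r}" for t
    using that by (auto simp: r_def amplitude_domain_def)
  hence "continuous_on {-r<..<r} (\<lambda>\<theta>. 1 / sqrt (1 - k\<^sup>2 * (sin \<theta>)\<^sup>2))"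
    using elliptic_integrand_pos[OF k] by (intro continuous_intros) (metis less_irrefl real_sqrt_eq_zero_cancel_iff)
  from interval_integral_has_real_derivative[OF this, of 0 \<phi>] show ?thesis
    using r unfolding elliptic_F_def[abs_def] by (simp add: zero_ereal_def)
qed

lemma elliptic_F_0 [simp]: "elliptic_F k 0 = 0"
  by (simp add: elliptic_F_def zero_ereal_def)

text \<open>The integrand is at least \<open>1\<close>. This expansion property makes the elliptic integral injective
  and, for modulus below \<open>1\<close>, unbounded in both directions; it also makes the amplitude Lipschitz and
  hence continuous.\<close>

lemma elliptic_F_expanding:
  assumes k: "0 \<le> k" "k \<le> 1" and dom: "a \<in> amplitude_domain k" "b \<in> amplitude_domain k" and "a \<le> b"
  shows "b - a \<le> elliptic_F k b - elliptic_F k a"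
proof -
  have "\<exists>y. ((\<lambda>t. elliptic_F k t - t) has_real_derivative y) (at t) \<and> 0 \<le> y"
    if "a \<le> t" "t \<le> b" for t
  proof -
    have t: "t \<in> amplitude_domain k" using that dom by (auto simp: amplitude_domain_def)
    have "1 \<le> 1 / sqrt (1 - k\<^sup>2 * (sin t)\<^sup>2)"
      using elliptic_integrand_pos[OF k t] by (simp add: le_divide_eq)
    thus ?thesis
      using DERIV_diff[OF DERIV_elliptic_F[OF k t] DERIV_ident] by fastforce
  qed
  from DERIV_nonneg_imp_nondecreasing[OF \<open>a \<le> b\<close> this] show ?thesis by simp
qed

lemma elliptic_F_expanding_abs:
  assumes "0 \<le> k" "k \<le> 1" "a \<in> amplitude_domain k" "b \<in> amplitude_domain k"
  shows "\<bar>b - a\<bar> \<le> \<bar>elliptic_F k b - elliptic_F k a\<bar>"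
  using elliptic_F_expanding[OF assms] elliptic_F_expanding[OF assms(1,2,4,3)] by linarith

text \<open>For modulus \<open>1\<close> the solution of \<open>F \<phi> = u\<close> is the Gudermannian function \<open>\<phi> = arctan (sinh u)\<close>.\<close>

lemma elliptic_F_surj:
  assumes k: "0 \<le> k" "k \<le> 1"
  shows "\<exists>\<phi>\<in>amplitude_domain k. elliptic_F k \<phi> = u"
proof (cases "k = 1")
  case True
  have "((\<lambda>t. elliptic_F 1 (arctan (sinh t)) - t) has_real_derivative 0) (at t)" for t :: real
  proof -
    have dom: "arctan (sinh t) \<in> amplitude_domain 1"
      using arctan_bounded[of "sinh t"] by (auto simp: amplitude_domain_def)
    have "0 < cos (arctan (sinh t))"
      using arctan_bounded[of "sinh t"] by (intro cos_gt_zero_pi) auto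
    hence "sqrt (1 - (sin (arctan (sinh t)))\<^sup>2) = cos (arctan (sinh t))"
      by (subst cos_squared_eq[symmetric]) simp
    also have "\<dots> = 1 / cosh t"
      using cosh_square_eq[of t] by (simp add: cos_arctan add.commute[of 1] real_sqrt_unique)
    finally have s: "1 / sqrt (1 - 1\<^sup>2 * (sin (arctan (sinh t)))\<^sup>2) = cosh t" by simp
    have "((\<lambda>t. arctan (sinh t)) has_real_derivative 1 / cosh t) (at t)"
    proof -
      have c: "1 + (sinh t)\<^sup>2 = cosh t * cosh t"
        using cosh_square_eq[of t] by (simp add: power2_eq_square)
      have "((\<lambda>t. arctan (sinh t)) has_real_derivative inverse (1 + (sinh t)\<^sup>2) * (cosh t * 1)) (at t)"
        by (rule DERIV_chain2[OF DERIV_arctan has_field_derivative_sinh[OF DERIV_ident]])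
      thus ?thesis unfolding c by (simp add: inverse_eq_divide)
    qed
    from DERIV_chain2[OF DERIV_elliptic_F[OF _ _ dom, unfolded s] this]
    have "((\<lambda>t. elliptic_F 1 (arctan (sinh t))) has_real_derivative 1) (at t)" by simp
    from DERIV_diff[OF this DERIV_ident] show ?thesis by simp
  qed
  hence "elliptic_F 1 (arctan (sinh u)) - u = elliptic_F 1 (arctan (sinh 0)) - 0"
    by (intro DERIV_isconst_all) simp
  moreover have "arctan (sinh u) \<in> amplitude_domain 1"
    using arctan_bounded[of "sinh u"] by (auto simp: amplitude_domain_def)
  ultimately show ?thesis using True by auto
next
  case False
  hence dom: "t \<in> amplitude_domain k" for t by (auto simp: amplitude_domain_def)
  have "elliptic_F k (- \<bar>u\<bar>) \<le> u" "u \<le> elliptic_F k \<bar>u\<bar>"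
    using elliptic_F_expanding[OF k dom dom, of "-\<bar>u\<bar>" 0] elliptic_F_expanding[OF k dom dom, of 0 "\<bar>u\<bar>"]
    by auto
  then obtain \<phi> where "elliptic_F k \<phi> = u"
    using IVT[of "elliptic_F k" "-\<bar>u\<bar>" u "\<bar>u\<bar>"] DERIV_isCont[OF DERIV_elliptic_F[OF k dom]] by auto
  thus ?thesis using dom by blast
qed

lemma
  assumes k: "0 \<le> k" "k \<le> 1"
  shows jacobi_am_in_domain: "jacobi_am k u \<in> amplitude_domain k"
    and elliptic_F_jacobi_am: "elliptic_F k (jacobi_am k u) = u"
    and jacobi_am_elliptic_F: "\<phi> \<in> amplitude_domain k \<Longrightarrow> jacobi_am k (elliptic_F k \<phi>) = \<phi>"
proof -
  have uniq: "\<phi> = \<psi>" if "\<phi> \<in> amplitude_domain k" "\<psi> \<in> amplitude_domain k"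
    "elliptic_F k \<phi> = elliptic_F k \<psi>" for \<phi> \<psi>
    using elliptic_F_expanding_abs[OF k that(1,2)] that(3) by simp
  have am: "jacobi_am k u = (THE \<phi>. \<phi> \<in> amplitude_domain k \<and> elliptic_F k \<phi> = u)" for u
    by (simp add: jacobi_am_def amplitude_domain_def)
  have "jacobi_am k u \<in> amplitude_domain k \<and> elliptic_F k (jacobi_am k u) = u"
    unfolding am by (rule theI') (use elliptic_F_surj[OF k] uniq in metis)
  thus "jacobi_am k u \<in> amplitude_domain k" "elliptic_F k (jacobi_am k u) = u" by auto
  show "jacobi_am k (elliptic_F k \<phi>) = \<phi>" if "\<phi> \<in> amplitude_domain k"
    unfolding am by (rule the_equality) (use that uniq in auto)
qed

lemma jacobi_dn_pos: "0 \<le> k \<Longrightarrow> k \<le> 1 \<Longrightarrow> 0 < jacobi_dn k u"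
  unfolding jacobi_dn_def jacobi_sn_def
  by (simp only: real_sqrt_gt_0_iff elliptic_integrand_pos jacobi_am_in_domain)

lemma jacobi_dn_square: "0 \<le> k \<Longrightarrow> k \<le> 1 \<Longrightarrow> (jacobi_dn k u)\<^sup>2 = 1 - k\<^sup>2 * (jacobi_sn k u)\<^sup>2"
  using jacobi_dn_pos[of k u] by (simp add: jacobi_dn_def)

lemma jacobi_cn_square: "(jacobi_cn k u)\<^sup>2 = 1 - (jacobi_sn k u)\<^sup>2"
  by (simp add: jacobi_cn_def jacobi_sn_def cos_squared_eq)

lemma jacobi_at_0 [simp]:
  assumes "0 \<le> k" "k \<le> 1"
  shows "jacobi_sn k 0 = 0" "jacobi_cn k 0 = 1" "jacobi_dn k 0 = 1"
proof -
  have "jacobi_am k 0 = 0"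
    using jacobi_am_elliptic_F[OF assms, of 0] by (simp add: amplitude_domain_def)
  thus "jacobi_sn k 0 = 0" "jacobi_cn k 0 = 1" "jacobi_dn k 0 = 1"
    by (simp_all add: jacobi_sn_def jacobi_cn_def jacobi_dn_def)
qed

text \<open>The inverse function theorem for \<open>elliptic_F k\<close>, whose derivative at the amplitude is \<open>1 / dn\<close>.\<close>

lemma DERIV_jacobi_am:
  assumes k: "0 \<le> k" "k \<le> 1"
  shows "(jacobi_am k has_real_derivative jacobi_dn k u) (at u)"
proof -
  note dom = jacobi_am_in_domain[OF k]
  have "isCont (jacobi_am k) u"
  proof (rule lipschitz_on_continuous_within)
    show "1-lipschitz_on UNIV (jacobi_am k)"
      using elliptic_F_expanding_abs[OF k dom dom]
      by (intro lipschitz_onI) (simp_all add: dist_real_def elliptic_F_jacobi_am[OF k])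
  qed auto
  hence "DERIV (jacobi_am k) u :> inverse (1 / sqrt (1 - k\<^sup>2 * (sin (jacobi_am k u))\<^sup>2))"
    using elliptic_integrand_pos[OF k dom[of u]]
    by (intro DERIV_inverse_function[where f = "elliptic_F k" and g = "jacobi_am k", OF DERIV_elliptic_F[OF k dom[of u]], of "u - 1" "u + 1"])
       (auto simp: elliptic_F_jacobi_am[OF k])
  thus ?thesis by (simp add: jacobi_dn_def jacobi_sn_def)
qed

lemma DERIV_jacobi_sn:
  assumes "0 \<le> k" "k \<le> 1"
  shows "(jacobi_sn k has_real_derivative jacobi_cn k u * jacobi_dn k u) (at u)"
  unfolding jacobi_sn_def[abs_def] jacobi_cn_def
  using DERIV_chain2[OF DERIV_sin DERIV_jacobi_am[OF assms]] by simp

lemma DERIV_jacobi_cn: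
  assumes "0 \<le> k" "k \<le> 1"
  shows "(jacobi_cn k has_real_derivative - (jacobi_sn k u * jacobi_dn k u)) (at u)"
  unfolding jacobi_cn_def[abs_def] jacobi_sn_def
  using DERIV_chain2[OF DERIV_cos DERIV_jacobi_am[OF assms]] by simp

lemma DERIV_jacobi_dn:
  assumes "0 \<le> k" "k \<le> 1"
  shows "(jacobi_dn k has_real_derivative - (k\<^sup>2 * jacobi_sn k u * jacobi_cn k u)) (at u)"
proof -
  define d where "d = jacobi_dn k u"
  have d: "sqrt (1 - k\<^sup>2 * (jacobi_sn k u)\<^sup>2) = d" "d > 0"
    using jacobi_dn_pos[OF assms, of u] by (simp_all add: jacobi_dn_def d_def)
  hence "0 < 1 - k\<^sup>2 * (jacobi_sn k u)\<^sup>2"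
    by (metis real_sqrt_gt_0_iff)
  hence "((\<lambda>u. sqrt (1 - k\<^sup>2 * (jacobi_sn k u)\<^sup>2)) has_real_derivative
      (- (k\<^sup>2 * (2 * jacobi_sn k u * (jacobi_cn k u * d)))) * (inverse d / 2)) (at u)"
    using d unfolding d_def
    by (auto intro!: derivative_eq_intros DERIV_jacobi_sn[OF assms])
  moreover have "jacobi_dn k = (\<lambda>u. sqrt (1 - k\<^sup>2 * (jacobi_sn k u)\<^sup>2))"
    by (simp add: jacobi_dn_def fun_eq_iff)
  moreover have "(- (k\<^sup>2 * (2 * jacobi_sn k u * (jacobi_cn k u * d)))) * (inverse d / 2)
      = - (k\<^sup>2 * jacobi_sn k u * jacobi_cn k u)"
    using d(2) by (simp add: inverse_eq_divide)
  ultimately show ?thesis by metis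
qed

section \<open>The quarter period halved, and a duplication formula\<close>

text \<open>If \<open>tan \<phi> tan \<psi> = 1 / k'\<close>, then \<open>F \<phi> + F \<psi> = K\<close>: the derivative of the left hand side along this curve
  vanishes, and \<open>\<phi> = 0\<close> gives \<open>\<psi> = \<pi>/2\<close>. The value of \<open>F\<close> at the symmetric point
  \<open>\<phi> = \<psi>\<close>, where \<open>tan \<phi> = 1 / sqrt k'\<close>, is therefore \<open>K / 2\<close>.\<close>

lemma elliptic_half_period:
  assumes k: "0 \<le> k" "k < 1"
  defines "\<phi> \<equiv> arctan (1 / sqrt (sqrt (1 - k\<^sup>2)))"
  shows "elliptic_F k \<phi> = elliptic_K k / 2"
proof -
  define k' where "k' = sqrt (1 - k\<^sup>2)"
  have k1: "k \<le> 1" and k2: "k\<^sup>2 < 1" using k by (auto simp: power_less_one_iff abs_square_less_1)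
  have k': "0 < k'" "k'\<^sup>2 = 1 - k\<^sup>2" using k2 by (auto simp: k'_def)
  have dom: "t \<in> amplitude_domain k" for t using k by (auto simp: amplitude_domain_def)
  note F' = DERIV_elliptic_F[OF k(1) k1 dom]
  define \<psi> where "\<psi> t = pi / 2 - arctan (k' * tan t)" for t
  have phi: "0 < \<phi>" "\<phi> < pi / 2" "tan \<phi> = 1 / sqrt k'"
    using arctan_ubound k'(1) by (simp_all add: \<phi>_def k'_def tan_arctan)
  have "((\<lambda>t. elliptic_F k t + elliptic_F k (\<psi> t)) has_real_derivative 0) (at t)"
    if t: "0 \<le> t" "t \<le> \<phi>" for t
  proof -
    have ct: "cos t > 0" using t phi by (intro cos_gt_zero_pi) auto
    define T where "T = tan t"
    define R where "R = sqrt (1 + (k' * T)\<^sup>2)"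
    have R: "R > 0" "R\<^sup>2 = 1 + (k' * T)\<^sup>2" by (auto simp: R_def add_pos_nonneg)
    have T2: "inverse ((cos t)\<^sup>2) = 1 + T\<^sup>2" 
      using tan_sec[of t] ct by (simp add: T_def power_inverse)
    \<comment> \<open>Everything is expressed through \<open>T = tan t\<close>; note that \<open>cos (arctan (k' T)) = 1 / R\<close>.\<close>
    have "sin (\<psi> t) = 1 / R"
      by (simp add: \<psi>_def sin_diff cos_arctan R_def T_def)
    hence "1 - k\<^sup>2 * (sin (\<psi> t))\<^sup>2 = (R\<^sup>2 - k\<^sup>2) / R\<^sup>2"
      using R(1) by (simp add: power_divide diff_divide_distrib)
    also have "R\<^sup>2 - k\<^sup>2 = (1 + T\<^sup>2) * k'\<^sup>2"
      unfolding R(2) power_mult_distrib k'(2) by (simp add: algebra_simps)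
    finally have "1 - k\<^sup>2 * (sin (\<psi> t))\<^sup>2 = (1 + T\<^sup>2) * k'\<^sup>2 / R\<^sup>2" .
    hence s1: "sqrt (1 - k\<^sup>2 * (sin (\<psi> t))\<^sup>2) = sqrt (1 + T\<^sup>2) * k' / R"
      using R(1) k'(1) by (simp add: real_sqrt_mult real_sqrt_divide)
    have "(sin t)\<^sup>2 = T\<^sup>2 / inverse ((cos t)\<^sup>2)"
      using ct by (simp add: T_def tan_def power_divide)
    hence "(sin t)\<^sup>2 = T\<^sup>2 / (1 + T\<^sup>2)" unfolding T2 .
    moreover have "1 + T\<^sup>2 \<noteq> 0" by (smt (verit) zero_le_power2)
    ultimately have "1 - k\<^sup>2 * (sin t)\<^sup>2 = ((1 + T\<^sup>2) - k\<^sup>2 * T\<^sup>2) / (1 + T\<^sup>2)"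
      by (simp add: diff_divide_distrib)
    also have "(1 + T\<^sup>2) - k\<^sup>2 * T\<^sup>2 = R\<^sup>2"
      unfolding R(2) power_mult_distrib k'(2) by (simp add: algebra_simps)
    finally have "1 - k\<^sup>2 * (sin t)\<^sup>2 = R\<^sup>2 / (1 + T\<^sup>2)" .
    hence s2: "sqrt (1 - k\<^sup>2 * (sin t)\<^sup>2) = R / sqrt (1 + T\<^sup>2)"
      using R(1) by (simp add: real_sqrt_divide)
    have "(tan has_real_derivative 1 + T\<^sup>2) (at t)"
      using DERIV_tan[of t] ct T2 by simp
    hence "((\<lambda>t. k' * tan t) has_real_derivative k' * (1 + T\<^sup>2)) (at t)"
      by (rule DERIV_cmult)
    from DERIV_diff[OF DERIV_const[of "pi / 2"] DERIV_chain2[OF DERIV_arctan this]]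
    have "(\<psi> has_real_derivative - (k' * (1 + T\<^sup>2) / R\<^sup>2)) (at t)"
      unfolding \<psi>_def[abs_def] R(2) by (rule DERIV_cong) (simp add: T_def inverse_eq_divide)
    note DERIV_add[OF F' DERIV_chain2[OF F' this]]
    moreover have "1 / sqrt (1 - k\<^sup>2 * (sin t)\<^sup>2)
        + 1 / sqrt (1 - k\<^sup>2 * (sin (\<psi> t))\<^sup>2) * - (k' * (1 + T\<^sup>2) / R\<^sup>2) = 0"
    proof -
      define m where "m = sqrt (1 + T\<^sup>2)"
      have m: "m > 0" "1 + T\<^sup>2 = m\<^sup>2" by (auto simp: m_def add_pos_nonneg)
      show ?thesis unfolding s1 s2 m_def[symmetric] unfolding m(2)
        using m(1) R(1) k'(1) by (simp add: field_simps power2_eq_square)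
    qed
    ultimately show ?thesis by metis
  qed
  hence const: "((\<lambda>t. elliptic_F k t + elliptic_F k (\<psi> t)) has_real_derivative 0) (at t)"
    if "0 \<le> t" "t \<le> \<phi>" for t using that by blast
  have "elliptic_F k \<phi> + elliptic_F k (\<psi> \<phi>) = elliptic_F k 0 + elliptic_F k (\<psi> 0)"
  proof (rule DERIV_isconst_end[where f = "\<lambda>t. elliptic_F k t + elliptic_F k (\<psi> t)", OF phi(1)])
    show "continuous_on {0..\<phi>} (\<lambda>t. elliptic_F k t + elliptic_F k (\<psi> t))"
      by (rule DERIV_continuous_on[where D = "\<lambda>_. 0"]) (auto intro: has_field_derivative_at_within[OF const])
  qed (rule const, simp_all)
  moreover have "\<psi> \<phi> = \<phi>"
  proof -
    have "arctan (1 / sqrt k') = pi / 2 - arctan (sqrt k')"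
      using k'(1) arctan_inverse[of "sqrt k'"] by (simp add: inverse_eq_divide)
    moreover have "k' * (1 / sqrt k') = sqrt k'" using k'(1) by (simp add: real_div_sqrt)
    ultimately show ?thesis unfolding \<psi>_def phi(3) by (simp add: \<phi>_def k'_def)
  qed
  moreover have "\<psi> 0 = pi / 2" by (simp add: \<psi>_def)
  ultimately show ?thesis by (simp add: elliptic_K_def)
qed

lemma jacobi_half_period:
  assumes k: "0 \<le> k" "k < 1"
  defines "k' \<equiv> sqrt (1 - k\<^sup>2)"
  shows "jacobi_sn k (elliptic_K k / 2) = 1 / sqrt (1 + k')"
    and "jacobi_cn k (elliptic_K k / 2) = sqrt k' / sqrt (1 + k')"
    and "jacobi_dn k (elliptic_K k / 2) = sqrt k'"
proof -
  have k1: "k \<le> 1" and k2: "k\<^sup>2 < 1" using k by (auto simp: power_less_one_iff abs_square_less_1)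
  have k': "0 < k'" "k'\<^sup>2 = 1 - k\<^sup>2" using k2 by (auto simp: k'_def)
  define \<phi> where "\<phi> = arctan (1 / sqrt k')"
  have "jacobi_am k (elliptic_K k / 2) = \<phi>"
    using jacobi_am_elliptic_F[OF k(1) k1, of \<phi>] elliptic_half_period[OF k] k
    by (simp add: \<phi>_def k'_def amplitude_domain_def)
  moreover have q: "sqrt (1 + (1 / sqrt k')\<^sup>2) = sqrt (1 + k') / sqrt k'"
    using k'(1) by (simp add: power_divide real_sqrt_divide[symmetric] field_simps)
  have "sin \<phi> = 1 / sqrt (1 + k')" "cos \<phi> = sqrt k' / sqrt (1 + k')"
    unfolding \<phi>_def sin_arctan cos_arctan q using k'(1) by simp_all
  ultimately show sn: "jacobi_sn k (elliptic_K k / 2) = 1 / sqrt (1 + k')"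
    and "jacobi_cn k (elliptic_K k / 2) = sqrt k' / sqrt (1 + k')"
    by (simp_all add: jacobi_sn_def jacobi_cn_def)
  have "1 - k\<^sup>2 * (1 / sqrt (1 + k'))\<^sup>2 = k'"
    using k'(1) k'(2) by (simp add: power_divide field_simps power2_eq_square)
  thus "jacobi_dn k (elliptic_K k / 2) = sqrt k'"
    unfolding jacobi_dn_def sn by simp
qed

lemma modulus_sn_abs_less_1:
  assumes "0 \<le> k" "k \<le> 1"
  shows "\<bar>k * jacobi_sn k u\<bar> < 1"
proof -
  have "(k * jacobi_sn k u)\<^sup>2 < 1"
    using jacobi_dn_square[OF assms, of u] jacobi_dn_pos[OF assms, of u]
    by (smt (verit) power_mult_distrib zero_less_power)
  thus ?thesis by (simp add: abs_square_less_1)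
qed

text \<open>For fixed \<open>a\<close> the right hand side has derivative \<open>0\<close> in \<open>u\<close>, so it may be evaluated at \<open>u = 0\<close>. This is the
  sum of the addition theorems for \<open>dn\<close> and \<open>k cn\<close>, in which the common factor \<open>1 - k sn u sn v\<close> of
  numerator and denominator cancels (here \<open>v = a - u\<close>).\<close>

lemma jacobi_dn_cn_addition:
  assumes k: "0 \<le> k" "k \<le> 1"
  shows "jacobi_dn k a + k * jacobi_cn k a =
    (jacobi_dn k u * jacobi_dn k (a - u) + k * (jacobi_cn k u * jacobi_cn k (a - u)))
      / (1 + k * (jacobi_sn k u * jacobi_sn k (a - u)))"
proof -
  define N where "N u = jacobi_dn k u * jacobi_dn k (a - u) + k * (jacobi_cn k u * jacobi_cn k (a - u))" for u
  define M where "M u = 1 + k * (jacobi_sn k u * jacobi_sn k (a - u))" for u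
  have M: "M u > 0" for u
  proof -
    have "\<bar>k * jacobi_sn k u\<bar> * \<bar>jacobi_sn k (a - u)\<bar> \<le> \<bar>k * jacobi_sn k u\<bar> * 1"
      by (intro mult_left_mono) (auto simp: jacobi_sn_def)
    hence "\<bar>k * (jacobi_sn k u * jacobi_sn k (a - u))\<bar> < 1"
      using modulus_sn_abs_less_1[OF k, of u] by (simp add: abs_mult mult.assoc)
    thus ?thesis by (simp add: M_def abs_less_iff)
  qed
  have "((\<lambda>u. N u / M u) has_real_derivative 0) (at u)" for u
  proof -
    define s c d t e f where defs: "s = jacobi_sn k u" "c = jacobi_cn k u" "d = jacobi_dn k u"
      "t = jacobi_sn k (a - u)" "e = jacobi_cn k (a - u)" "f = jacobi_dn k (a - u)"
    have sq: "d\<^sup>2 = 1 - k\<^sup>2 * s\<^sup>2" "c\<^sup>2 = 1 - s\<^sup>2" "e\<^sup>2 = 1 - t\<^sup>2" "f\<^sup>2 = 1 - k\<^sup>2 * t\<^sup>2"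
      unfolding defs by (simp_all add: jacobi_dn_square[OF k] jacobi_cn_square)
    have au: "((\<lambda>u. a - u) has_real_derivative -1) (at u)"
      by (auto intro!: derivative_eq_intros)
    note D = DERIV_jacobi_sn[OF k, of u, folded defs] DERIV_jacobi_cn[OF k, of u, folded defs]
      DERIV_jacobi_dn[OF k, of u, folded defs]
      DERIV_chain2[OF DERIV_jacobi_sn[OF k] au, folded defs] DERIV_chain2[OF DERIV_jacobi_cn[OF k] au, folded defs]
      DERIV_chain2[OF DERIV_jacobi_dn[OF k] au, folded defs]
    have N': "(N has_real_derivative (- (k\<^sup>2 * s * c)) * f + (- (k\<^sup>2 * t * e) * -1) * d
         + k * ((- (s * d)) * e + (- (t * f) * -1) * c)) (at u)"
      unfolding N_def[abs_def] defs
      by (intro DERIV_add DERIV_mult DERIV_cmult D[unfolded defs])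
    have M': "(M has_real_derivative 0 + k * (c * d * t + e * f * -1 * s)) (at u)"
      unfolding M_def[abs_def] defs
      by (intro DERIV_add DERIV_mult DERIV_cmult DERIV_const D[unfolded defs])
    have "((- (k\<^sup>2 * s * c)) * f + (- (k\<^sup>2 * t * e) * -1) * d + k * ((- (s * d)) * e + (- (t * f) * -1) * c)) * M u
        - N u * (0 + k * (c * d * t + e * f * -1 * s)) = 0"
      unfolding M_def N_def defs[symmetric] using sq by algebra
    with DERIV_divide[OF N' M'] M[of u] show ?thesis by simp
  qed
  hence "N u / M u = N 0 / M 0" by (intro DERIV_isconst_all) simp
  thus ?thesis using k by (simp add: N_def M_def)
qed

lemma jacobi_dn_cn_half_argument:
  assumes k: "0 \<le> k" "k \<le> 1"
  shows "jacobi_dn k x + k * jacobi_cn k x =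
    (1 + k) * (1 - k * (jacobi_sn k (x / 2))\<^sup>2) / (1 + k * (jacobi_sn k (x / 2))\<^sup>2)"
proof -
  have "jacobi_dn k x + k * jacobi_cn k x =
    ((jacobi_dn k (x / 2))\<^sup>2 + k * (jacobi_cn k (x / 2))\<^sup>2) / (1 + k * (jacobi_sn k (x / 2))\<^sup>2)"
    using jacobi_dn_cn_addition[OF k, of x "x / 2"] by (simp add: power2_eq_square)
  thus ?thesis
    unfolding jacobi_dn_square[OF k] jacobi_cn_square
    by (simp add: algebra_simps power2_eq_square)
qed

section \<open>The meromorphic continuation of sn\<close>

text \<open>The difference is meromorphic and vanishes on the real axis, so the identity theorem makes it vanish near every
  point, except possibly at the point itself. The values there agree because a nicely meromorphic function is determined by
  its values nearby: it has the value of its limit, or \<open>0\<close> at a pole.\<close>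

lemma nicely_meromorphic_determined_by_reals:
  assumes f: "f nicely_meromorphic_on UNIV" and g: "g nicely_meromorphic_on UNIV"
    and eq: "\<And>u::real. f (of_real u) = g (of_real u)"
  shows "f = g"
proof
  fix z
  have "(\<lambda>z. f z - g z) meromorphic_on UNIV"
    using f g by (intro meromorphic_intros) (auto simp: nicely_meromorphic_on_def)
  from meromorphic_imp_constant_or_avoid[OF this, of 0]
  have "(\<forall>z. \<forall>\<^sub>F w in at z. f w - g w = 0) \<or> (\<forall>z. \<forall>\<^sub>F w in at z. f w - g w \<noteq> 0)"
    by (simp add: eventually_cosparse_open_eq connected_UNIV)
  moreover have False if "\<forall>\<^sub>F w in at 0. f w - g w \<noteq> 0"
  proof -
    have "\<exists>r>0. \<forall>w\<in>UNIV. w \<noteq> 0 \<and> dist w 0 < r \<longrightarrow> f w - g w \<noteq> 0"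
      using that unfolding eventually_at .
    then obtain r where r: "r > 0" "\<forall>w\<in>UNIV. w \<noteq> 0 \<and> dist w 0 < r \<longrightarrow> f w - g w \<noteq> 0"
      by (elim exE conjE)
    have "f (of_real (r / 2)) - g (of_real (r / 2)) \<noteq> 0"
      by (rule bspec[OF r(2) UNIV_I, THEN mp]) (use r(1) in \<open>simp add: dist_norm\<close>)
    thus False unfolding eq by simp
  qed
  ultimately have "\<forall>\<^sub>F w in at z. f w - g w = 0" by blast
  hence ev: "\<forall>\<^sub>F w in at z. f w = g w" by simp
  have lim: "(f \<midarrow>z\<rightarrow> l) = (g \<midarrow>z\<rightarrow> l)" for l
    by (rule tendsto_cong) (fact ev)
  have pole: "is_pole f z = is_pole g z" by (rule is_pole_cong) (use ev in auto)
  have no_lim: False if "is_pole f z" "f \<midarrow>z\<rightarrow> l" for l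
    using that not_tendsto_and_filterlim_at_infinity[of "at z" f l] by (auto simp: is_pole_def)
  have "is_pole f z \<and> f z = 0 \<or> f \<midarrow>z\<rightarrow> f z" "is_pole g z \<and> g z = 0 \<or> g \<midarrow>z\<rightarrow> g z"
    using f g by (auto simp: nicely_meromorphic_on_def)
  thus "f z = g z"
    using pole no_lim lim tendsto_unique[of "at z" f "f z" "g z"] by auto
qed

text \<open>The Cauchy-Riemann equations for a quotient with real denominator. Clearing the denominators in the
  hypotheses lets them be checked as polynomial identities.\<close>

lemma has_field_derivative_Complex_quotient:
  fixes A B E :: "complex \<Rightarrow> real"
  assumes A: "(A has_derivative (\<lambda>h. A1 * Re h + A2 * Im h)) (at z)"
    and B: "(B has_derivative (\<lambda>h. B1 * Re h + B2 * Im h)) (at z)"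
    and E: "(E has_derivative (\<lambda>h. E1 * Re h + E2 * Im h)) (at z)"
    and nz: "E z \<noteq> 0"
    and CR: "A1 * E z - A z * E1 = B2 * E z - B z * E2"
            "A2 * E z - A z * E2 = - (B1 * E z - B z * E1)"
  shows "((\<lambda>w. Complex (A w / E w) (B w / E w)) has_field_derivative
           Complex ((A1 * E z - A z * E1) / (E z)\<^sup>2) ((B1 * E z - B z * E1) / (E z)\<^sup>2)) (at z)"
proof -
  define p where "p = (A1 * E z - A z * E1) / (E z)\<^sup>2"
  define q where "q = (B1 * E z - B z * E1) / (E z)\<^sup>2"
  have u: "((\<lambda>w. A w / E w) has_derivative (\<lambda>h. p * Re h - q * Im h)) (at z)"
  proof (rule has_derivative_eq_rhs[OF has_derivative_divide'[OF A E nz]], rule ext)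
    fix h
    have "((A1 * Re h + A2 * Im h) * E z - A z * (E1 * Re h + E2 * Im h)) / (E z * E z)
      = ((A1 * E z - A z * E1) * Re h + (A2 * E z - A z * E2) * Im h) / (E z)\<^sup>2"
      by (simp add: algebra_simps power2_eq_square)
    also have "\<dots> = p * Re h - q * Im h"
      unfolding CR(2) p_def q_def by (simp add: add_divide_distrib diff_divide_distrib algebra_simps)
    finally show "((A1 * Re h + A2 * Im h) * E z - A z * (E1 * Re h + E2 * Im h)) / (E z * E z)
      = p * Re h - q * Im h" .
  qed
  have v: "((\<lambda>w. B w / E w) has_derivative (\<lambda>h. q * Re h + p * Im h)) (at z)"
  proof (rule has_derivative_eq_rhs[OF has_derivative_divide'[OF B E nz]], rule ext)
    fix h
    have "((B1 * Re h + B2 * Im h) * E z - B z * (E1 * Re h + E2 * Im h)) / (E z * E z)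
      = ((B1 * E z - B z * E1) * Re h + (B2 * E z - B z * E2) * Im h) / (E z)\<^sup>2"
      by (simp add: algebra_simps power2_eq_square)
    also have "\<dots> = q * Re h + p * Im h"
      unfolding CR(1)[symmetric] p_def q_def by (simp add: add_divide_distrib diff_divide_distrib algebra_simps)
    finally show "((B1 * Re h + B2 * Im h) * E z - B z * (E1 * Re h + E2 * Im h)) / (E z * E z)
      = q * Re h + p * Im h" .
  qed
  have "((\<lambda>w. complex_of_real (A w / E w) + \<i> * complex_of_real (B w / E w)) has_derivative
      (\<lambda>h. complex_of_real (p * Re h - q * Im h) + \<i> * complex_of_real (q * Re h + p * Im h))) (at z)"
    by (intro has_derivative_add has_derivative_mult_right
        bounded_linear.has_derivative[OF bounded_linear_of_real u]
        bounded_linear.has_derivative[OF bounded_linear_of_real v])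
  moreover have "(\<lambda>h. complex_of_real (p * Re h - q * Im h) + \<i> * complex_of_real (q * Re h + p * Im h))
      = (*) (Complex p q)"
    by (auto simp: fun_eq_iff complex_eq_iff algebra_simps)
  moreover have "(\<lambda>w. complex_of_real (A w / E w) + \<i> * complex_of_real (B w / E w))
      = (\<lambda>w. Complex (A w / E w) (B w / E w))"
    by (auto simp: fun_eq_iff complex_eq_iff)
  ultimately show ?thesis
    unfolding has_field_derivative_def p_def q_def by metis
qed

definition compl_modulus :: "real \<Rightarrow> real" where
  "compl_modulus k = sqrt (1 - k\<^sup>2)"

lemma compl_modulus:
  assumes "0 \<le> k" "k \<le> 1"
  shows "0 \<le> compl_modulus k" "compl_modulus k \<le> 1" "(compl_modulus k)\<^sup>2 = 1 - k\<^sup>2"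
  using modulus_square_le_1[OF assms] by (auto simp: compl_modulus_def)

text \<open>The ingredients of the formula for \<open>sn (x + i y)\<close> that the addition theorem and Jacobi's imaginary transformation
  predict. The reciprocal has the conjugate numerator and the denominator \<open>sn_recip_den\<close>; it is regular at the poles of
  \<open>sn\<close>.\<close>

definition sn_num_re :: "real \<Rightarrow> complex \<Rightarrow> real" where
  "sn_num_re k z = jacobi_sn k (Re z) * jacobi_dn (compl_modulus k) (Im z)"

definition sn_num_im :: "real \<Rightarrow> complex \<Rightarrow> real" where
  "sn_num_im k z = jacobi_cn k (Re z) * jacobi_dn k (Re z) *
     (jacobi_sn (compl_modulus k) (Im z) * jacobi_cn (compl_modulus k) (Im z))"

definition sn_den :: "real \<Rightarrow> complex \<Rightarrow> real" where
  "sn_den k z = (jacobi_cn (compl_modulus k) (Im z))\<^sup>2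
     + k\<^sup>2 * ((jacobi_sn k (Re z))\<^sup>2 * (jacobi_sn (compl_modulus k) (Im z))\<^sup>2)"

definition sn_recip_den :: "real \<Rightarrow> complex \<Rightarrow> real" where
  "sn_recip_den k z = (jacobi_sn (compl_modulus k) (Im z))\<^sup>2
     + (jacobi_sn k (Re z))\<^sup>2 * (jacobi_cn (compl_modulus k) (Im z))\<^sup>2"

definition sn_ext :: "real \<Rightarrow> complex \<Rightarrow> complex" where
  "sn_ext k z = Complex (sn_num_re k z / sn_den k z) (sn_num_im k z / sn_den k z)"

definition sn_recip_ext :: "real \<Rightarrow> complex \<Rightarrow> complex" where
  "sn_recip_ext k z = Complex (sn_num_re k z / sn_recip_den k z) (- sn_num_im k z / sn_recip_den k z)"

context
  fixes k :: real
  assumes k: "0 \<le> k" "k \<le> 1"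
begin

lemmas complement_bounds = compl_modulus[OF k]

lemmas jacobi_part_derivatives =
  DERIV_compose_FDERIV[OF DERIV_jacobi_sn[OF k]] DERIV_compose_FDERIV[OF DERIV_jacobi_cn[OF k]]
  DERIV_compose_FDERIV[OF DERIV_jacobi_dn[OF k]]
  DERIV_compose_FDERIV[OF DERIV_jacobi_sn[OF complement_bounds(1,2)]] DERIV_compose_FDERIV[OF DERIV_jacobi_cn[OF complement_bounds(1,2)]]
  DERIV_compose_FDERIV[OF DERIV_jacobi_dn[OF complement_bounds(1,2)]]

text \<open>The relations \<open>1 - k\<^sup>2 s\<^sup>2 = d\<^sup>2\<close> and \<open>1 - s\<^sup>2 = c\<^sup>2\<close> collapse the derivatives of the two denominators in
  the imaginary direction to monomials.\<close>

lemma has_derivative_sn_parts: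
  fixes z :: complex
  defines "s \<equiv> jacobi_sn k (Re z)" and "c \<equiv> jacobi_cn k (Re z)" and "d \<equiv> jacobi_dn k (Re z)"
    and "t \<equiv> jacobi_sn (compl_modulus k) (Im z)" and "e \<equiv> jacobi_cn (compl_modulus k) (Im z)"
    and "f \<equiv> jacobi_dn (compl_modulus k) (Im z)"
  shows "(sn_num_re k has_derivative (\<lambda>h. (c * d * f) * Re h + (- ((1 - k\<^sup>2) * s * t * e)) * Im h)) (at z)"
    and "(sn_num_im k has_derivative
           (\<lambda>h. (- ((d\<^sup>2 + k\<^sup>2 * c\<^sup>2) * s * t * e)) * Re h + (c * d * f * (e\<^sup>2 - t\<^sup>2)) * Im h)) (at z)"
    and "(sn_den k has_derivative
           (\<lambda>h. (2 * k\<^sup>2 * s * c * d * t\<^sup>2) * Re h + (- (2 * t * e * f * d\<^sup>2)) * Im h)) (at z)"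
    and "(sn_recip_den k has_derivative
           (\<lambda>h. (2 * s * c * d * e\<^sup>2) * Re h + (2 * t * e * f * c\<^sup>2) * Im h)) (at z)"
proof -
  have d2: "d\<^sup>2 = 1 - k\<^sup>2 * s\<^sup>2" and c2: "c\<^sup>2 = 1 - s\<^sup>2"
    unfolding d_def s_def c_def by (rule jacobi_dn_square[OF k] jacobi_cn_square)+
  show "(sn_num_re k has_derivative (\<lambda>h. (c * d * f) * Re h + (- ((1 - k\<^sup>2) * s * t * e)) * Im h)) (at z)"
    unfolding sn_num_re_def[abs_def] s_def c_def d_def t_def e_def f_def
    by (rule has_derivative_eq_rhs, (rule jacobi_part_derivatives derivative_intros)+) (simp add: fun_eq_iff complement_bounds(3) algebra_simps)
  show "(sn_num_im k has_derivative
           (\<lambda>h. (- ((d\<^sup>2 + k\<^sup>2 * c\<^sup>2) * s * t * e)) * Re h + (c * d * f * (e\<^sup>2 - t\<^sup>2)) * Im h)) (at z)"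
    unfolding sn_num_im_def[abs_def] s_def c_def d_def t_def e_def f_def
    by (rule has_derivative_eq_rhs, (rule jacobi_part_derivatives derivative_intros)+)
       (simp add: fun_eq_iff algebra_simps power2_eq_square)
  show "(sn_den k has_derivative
           (\<lambda>h. (2 * k\<^sup>2 * s * c * d * t\<^sup>2) * Re h + (- (2 * t * e * f * d\<^sup>2)) * Im h)) (at z)"
    unfolding sn_den_def[abs_def] d2 unfolding s_def c_def d_def t_def e_def f_def
    by (rule has_derivative_eq_rhs, (rule jacobi_part_derivatives derivative_intros)+)
       (simp add: fun_eq_iff algebra_simps power2_eq_square)
  show "(sn_recip_den k has_derivative
           (\<lambda>h. (2 * s * c * d * e\<^sup>2) * Re h + (2 * t * e * f * c\<^sup>2) * Im h)) (at z)"
    unfolding sn_recip_den_def[abs_def] c2 unfolding s_def c_def d_def t_def e_def f_def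
    by (rule has_derivative_eq_rhs, (rule jacobi_part_derivatives derivative_intros)+)
       (simp add: fun_eq_iff algebra_simps power2_eq_square)
qed

text \<open>The squared modulus of the numerator factors into the two denominators. Hence the two quotients are
  reciprocal to each other, and wherever the denominator of \<open>sn\<close> vanishes, so does its numerator.\<close>

lemma sn_num_norm: "(sn_num_re k z)\<^sup>2 + (sn_num_im k z)\<^sup>2 = sn_den k z * sn_recip_den k z"
proof -
  define s c d t e f where defs: "s = jacobi_sn k (Re z)" "c = jacobi_cn k (Re z)" "d = jacobi_dn k (Re z)"
    "t = jacobi_sn (compl_modulus k) (Im z)" "e = jacobi_cn (compl_modulus k) (Im z)"
    "f = jacobi_dn (compl_modulus k) (Im z)"
  have sq: "d\<^sup>2 = 1 - k\<^sup>2 * s\<^sup>2" "c\<^sup>2 = 1 - s\<^sup>2" "e\<^sup>2 = 1 - t\<^sup>2" "f\<^sup>2 = 1 - (1 - k\<^sup>2) * t\<^sup>2"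
    using jacobi_dn_square[OF complement_bounds(1,2), of "Im z"] 
    unfolding defs complement_bounds(3) by (simp_all add: jacobi_dn_square[OF k] jacobi_cn_square)
  show ?thesis
    unfolding sn_num_re_def sn_num_im_def sn_den_def sn_recip_den_def defs[symmetric] power_mult_distrib sq
    by algebra
qed

lemma
  fixes z :: complex
  defines "s \<equiv> jacobi_sn k (Re z)" and "c \<equiv> jacobi_cn k (Re z)" and "d \<equiv> jacobi_dn k (Re z)"
    and "t \<equiv> jacobi_sn (compl_modulus k) (Im z)" and "e \<equiv> jacobi_cn (compl_modulus k) (Im z)"
    and "f \<equiv> jacobi_dn (compl_modulus k) (Im z)"
  shows sn_ext_differentiable: "sn_den k z \<noteq> 0 \<Longrightarrow> sn_ext k field_differentiable at z"
    and sn_recip_ext_differentiable: "sn_recip_den k z \<noteq> 0 \<Longrightarrow> sn_recip_ext k field_differentiable at z"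
proof -
  have sq: "d\<^sup>2 = 1 - k\<^sup>2 * s\<^sup>2" "c\<^sup>2 = 1 - s\<^sup>2" "e\<^sup>2 = 1 - t\<^sup>2" "f\<^sup>2 = 1 - (1 - k\<^sup>2) * t\<^sup>2"
    using jacobi_dn_square[OF complement_bounds(1,2), of "Im z"] 
    unfolding s_def c_def d_def t_def e_def f_def complement_bounds(3) by (simp_all add: jacobi_dn_square[OF k] jacobi_cn_square)
  note parts = has_derivative_sn_parts[of z, folded s_def c_def d_def t_def e_def f_def]
  have vals: "sn_num_re k z = s * f" "sn_num_im k z = c * d * (t * e)"
    "sn_den k z = e\<^sup>2 + k\<^sup>2 * (s\<^sup>2 * t\<^sup>2)" "sn_recip_den k z = t\<^sup>2 + s\<^sup>2 * e\<^sup>2"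
    by (simp_all add: s_def c_def d_def t_def e_def f_def sn_num_re_def sn_num_im_def sn_den_def sn_recip_den_def)
  show "sn_ext k field_differentiable at z" if "sn_den k z \<noteq> 0"
    unfolding field_differentiable_def sn_ext_def[abs_def]
  proof (rule exI, rule has_field_derivative_Complex_quotient[OF parts(1-3) that])
    show "c * d * f * sn_den k z - sn_num_re k z * (2 * k\<^sup>2 * s * c * d * t\<^sup>2)
      = c * d * f * (e\<^sup>2 - t\<^sup>2) * sn_den k z - sn_num_im k z * - (2 * t * e * f * d\<^sup>2)"
      unfolding vals using sq by algebra
    show "- ((1 - k\<^sup>2) * s * t * e) * sn_den k z - sn_num_re k z * - (2 * t * e * f * d\<^sup>2)
      = - (- ((d\<^sup>2 + k\<^sup>2 * c\<^sup>2) * s * t * e) * sn_den k z - sn_num_im k z * (2 * k\<^sup>2 * s * c * d * t\<^sup>2))"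
      unfolding vals using sq by algebra
  qed
  have neg: "((\<lambda>w. - sn_num_im k w) has_derivative
           (\<lambda>h. ((d\<^sup>2 + k\<^sup>2 * c\<^sup>2) * s * t * e) * Re h + (- (c * d * f * (e\<^sup>2 - t\<^sup>2))) * Im h)) (at z)"
    by (rule has_derivative_eq_rhs[OF has_derivative_minus[OF parts(2)]]) (simp add: fun_eq_iff)
  show "sn_recip_ext k field_differentiable at z" if "sn_recip_den k z \<noteq> 0"
    unfolding field_differentiable_def sn_recip_ext_def[abs_def]
  proof (rule exI, rule has_field_derivative_Complex_quotient[OF parts(1) neg parts(4) that])
    show "c * d * f * sn_recip_den k z - sn_num_re k z * (2 * s * c * d * e\<^sup>2)
      = - (c * d * f * (e\<^sup>2 - t\<^sup>2)) * sn_recip_den k z - - sn_num_im k z * (2 * t * e * f * c\<^sup>2)"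
      unfolding vals using sq by algebra
    show "- ((1 - k\<^sup>2) * s * t * e) * sn_recip_den k z - sn_num_re k z * (2 * t * e * f * c\<^sup>2)
      = - ((d\<^sup>2 + k\<^sup>2 * c\<^sup>2) * s * t * e * sn_recip_den k z - - sn_num_im k z * (2 * s * c * d * e\<^sup>2))"
      unfolding vals using sq by algebra
  qed
qed

text \<open>At a zero of \<open>sn_den\<close> both sides are \<open>0\<close>, the left one by the convention for division and the right one because the
  numerators vanish. This is the value that \<open>sn\<close> takes at its poles by convention.\<close>

lemma sn_ext_eq_inverse:
  assumes "sn_recip_den k z \<noteq> 0"
  shows "sn_ext k z = inverse (sn_recip_ext k z)"
proof (cases "sn_den k z = 0")
  case True
  hence "(sn_num_re k z)\<^sup>2 + (sn_num_im k z)\<^sup>2 = 0" using sn_num_norm[of z] by simp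
  hence "sn_num_re k z = 0" "sn_num_im k z = 0" by (simp_all add: sum_power2_eq_zero_iff)
  thus ?thesis by (simp add: sn_ext_def sn_recip_ext_def zero_complex.code[symmetric])
next
  case False
  have "sn_ext k z * sn_recip_ext k z
    = of_real (((sn_num_re k z)\<^sup>2 + (sn_num_im k z)\<^sup>2) / (sn_den k z * sn_recip_den k z))"
    by (simp add: sn_ext_def sn_recip_ext_def complex_eq_iff power2_eq_square add_divide_distrib)
  also have "\<dots> = 1" unfolding sn_num_norm using False assms by simp
  finally show ?thesis by (metis inverse_unique mult.commute)
qed

text \<open>Where \<open>sn_den\<close> does not vanish the function is holomorphic, and where \<open>sn_recip_den\<close> does not vanish it is the inverse of a
  holomorphic function. These two open sets cover the plane: a common zero of the denominators
  would give \<open>t = e = 0\<close>, contrary to \<open>t\<^sup>2 + e\<^sup>2 = 1\<close>.\<close>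

lemma sn_ext_nicely_meromorphic: "sn_ext k nicely_meromorphic_on UNIV"
proof -
  have cont: "continuous_on UNIV (sn_den k)" "continuous_on UNIV (sn_recip_den k)"
    using has_derivative_sn_parts(3,4) by (auto simp: continuous_on_eq_continuous_at intro: has_derivative_continuous)
  have op: "open {z. sn_den k z \<noteq> 0}" "open {z. sn_recip_den k z \<noteq> 0}"
    using cont by (intro open_Collect_neq continuous_on_const; simp)+
  have 1: "sn_ext k nicely_meromorphic_on {z. sn_den k z \<noteq> 0}"
    by (intro analytic_on_imp_nicely_meromorphic_on)
       (use op(1) in \<open>auto simp: analytic_on_open holomorphic_on_def
         intro!: field_differentiable_at_within sn_ext_differentiable\<close>)
  have "sn_recip_ext k nicely_meromorphic_on {z. sn_recip_den k z \<noteq> 0}"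
    by (intro analytic_on_imp_nicely_meromorphic_on)
       (use op(2) in \<open>auto simp: analytic_on_open holomorphic_on_def
         intro!: field_differentiable_at_within sn_recip_ext_differentiable\<close>)
  hence inv: "(\<lambda>z. inverse (sn_recip_ext k z)) nicely_meromorphic_on {z. sn_recip_den k z \<noteq> 0}"
    by (rule nicely_meromorphic_on_inverse)
  have ev: "\<forall>\<^sub>F w in at z. sn_ext k w = inverse (sn_recip_ext k w)" if "sn_recip_den k z \<noteq> 0" for z
    using eventually_at_in_open'[OF op(2), of z] that
    by (auto elim!: eventually_mono simp: sn_ext_eq_inverse)
  have 2: "sn_ext k nicely_meromorphic_on {z. sn_recip_den k z \<noteq> 0}"
    unfolding nicely_meromorphic_on_def
  proof (intro conjI ballI)
    show "sn_ext k meromorphic_on {z. sn_recip_den k z \<noteq> 0}"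
      using inv ev by (subst meromorphic_on_cong[OF _ refl]) (auto simp: nicely_meromorphic_on_def)
    fix z assume z: "z \<in> {z. sn_recip_den k z \<noteq> 0}"
    hence "is_pole (sn_ext k) z = is_pole (\<lambda>z. inverse (sn_recip_ext k z)) z"
      "(sn_ext k \<midarrow>z\<rightarrow> l) = ((\<lambda>z. inverse (sn_recip_ext k z)) \<midarrow>z\<rightarrow> l)" for l
      using ev by (auto intro!: is_pole_cong tendsto_cong)
    thus "is_pole (sn_ext k) z \<and> sn_ext k z = 0 \<or> sn_ext k \<midarrow>z\<rightarrow> sn_ext k z"
      using inv z sn_ext_eq_inverse[of z] by (auto simp: nicely_meromorphic_on_def)
  qed
  have "sn_den k z \<noteq> 0 \<or> sn_recip_den k z \<noteq> 0" for z
  proof (rule ccontr)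
    define t e where "t = jacobi_sn (compl_modulus k) (Im z)" "e = jacobi_cn (compl_modulus k) (Im z)"
    assume "\<not> ?thesis"
    hence "e = 0" "t = 0"
      by (auto simp: sn_den_def sn_recip_den_def add_nonneg_eq_0_iff simp flip: t_e_def)
    thus False using jacobi_cn_square[of "compl_modulus k" "Im z"] by (simp flip: t_e_def)
  qed
  thus ?thesis using 1 2 unfolding nicely_meromorphic_on_def meromorphic_on_def by blast
qed

lemma jacobi_sn_complex_eq: "jacobi_sn_complex k = sn_ext k"
proof -
  have real: "sn_ext k (of_real u) = of_real (jacobi_sn k u)" for u
    by (simp add: sn_ext_def sn_num_re_def sn_num_im_def sn_den_def jacobi_at_0[OF complement_bounds(1,2)] complex_eq_iff)
  show ?thesis unfolding jacobi_sn_complex_def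
  proof (rule the_equality)
    fix f assume "f nicely_meromorphic_on UNIV \<and> (\<forall>u::real. f (of_real u) = of_real (jacobi_sn k u))"
    thus "f = sn_ext k"
      using sn_ext_nicely_meromorphic real by (intro nicely_meromorphic_determined_by_reals) auto
  qed (use sn_ext_nicely_meromorphic real in auto)
qed

end

section \<open>The argument of sn on the middle line\<close>

text \<open>The function \<open>ring_weight q\<close> will turn out to be the derivative of \<open>ring_g q\<close>, and \<open>ring_phase q\<close> to be
  \<open>ring_g q\<close> itself.\<close>
definition ring_weight :: "real \<Rightarrow> real \<Rightarrow> real" where
  "ring_weight q x = (jacobi_dn q x + q * jacobi_cn q x) / 2"

definition ring_phase :: "real \<Rightarrow> real \<Rightarrow> real" where
  "ring_phase q x = (LBINT t=0..x. ring_weight q t)"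

lemma ring_weight_nonneg:
  assumes "0 \<le> q" "q \<le> 1"
  shows "0 \<le> ring_weight q x"
proof -
  have "(q * jacobi_cn q x)\<^sup>2 \<le> (jacobi_dn q x)\<^sup>2"
    using modulus_square_le_1[OF assms]
    by (simp add: jacobi_dn_square[OF assms] jacobi_cn_square power_mult_distrib algebra_simps)
  hence "\<bar>q * jacobi_cn q x\<bar> \<le> jacobi_dn q x"
    using jacobi_dn_pos[OF assms, of x] by (simp add: abs_le_square_iff[symmetric])
  thus ?thesis by (simp add: ring_weight_def)
qed

lemma DERIV_imp_continuous_on:
  fixes f :: "real \<Rightarrow> real"
  assumes "\<And>x. (f has_real_derivative f' x) (at x)"
  shows "continuous_on A f"
  by (rule DERIV_continuous_on[OF has_field_derivative_at_within[OF assms]])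

lemma continuous_on_ring_weight:
  assumes "0 \<le> q" "q \<le> 1"
  shows "continuous_on A (ring_weight q)"
proof -
  have "continuous_on A (jacobi_cn q)" "continuous_on A (jacobi_dn q)"
    by (rule DERIV_imp_continuous_on, rule DERIV_jacobi_cn[OF assms] DERIV_jacobi_dn[OF assms])+
  thus ?thesis unfolding ring_weight_def[abs_def] by (intro continuous_intros) auto
qed

lemma has_real_derivative_integral_from_0:
  assumes "continuous_on UNIV (f :: real \<Rightarrow> real)"
  shows "((\<lambda>x. LBINT t=0..x. f t) has_real_derivative f x) (at x)"
  unfolding zero_ereal_def
  by (rule interval_integral_has_real_derivative[where a = "- \<bar>x\<bar> - 1" and b = "\<bar>x\<bar> + 1"])
     (auto intro: continuous_on_subset[OF assms])

lemma ring_phase_0 [simp]: "ring_phase q 0 = 0"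
  by (simp add: ring_phase_def zero_ereal_def)

lemma DERIV_ring_phase:
  assumes "0 \<le> q" "q \<le> 1"
  shows "(ring_phase q has_real_derivative ring_weight q x) (at x)"
  unfolding ring_phase_def[abs_def]
  by (rule has_real_derivative_integral_from_0[OF continuous_on_ring_weight[OF assms]])

text \<open>The curves \<open>(C, S)\<close> and \<open>(cos \<theta>, sin \<theta>)\<close> rotate with the same angular velocity and start at the same point, so their
  inner product stays \<open>1\<close> and their determinant stays \<open>0\<close>.\<close>

lemma cos_sin_of_rotation:
  fixes C S \<theta> w :: "real \<Rightarrow> real"
  assumes C: "\<And>x. (C has_real_derivative - (w x * S x)) (at x)"
    and S: "\<And>x. (S has_real_derivative w x * C x) (at x)"
    and \<theta>: "\<And>x. (\<theta> has_real_derivative w x) (at x)"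
    and init: "C 0 = 1" "S 0 = 0" "\<theta> 0 = 0"
  shows "cos (\<theta> x) = C x" "sin (\<theta> x) = S x"
proof -
  have co: "((\<lambda>x. cos (\<theta> x)) has_real_derivative - sin (\<theta> x) * w x) (at x)" for x
    by (rule DERIV_chain2[OF DERIV_cos \<theta>])
  have si: "((\<lambda>x. sin (\<theta> x)) has_real_derivative cos (\<theta> x) * w x) (at x)" for x
    by (rule DERIV_chain2[OF DERIV_sin \<theta>])
  have "((\<lambda>x. C x * cos (\<theta> x) + S x * sin (\<theta> x)) has_real_derivative 0) (at x)" for x
    by (rule DERIV_cong[OF DERIV_add[OF DERIV_mult[OF C co] DERIV_mult[OF S si]]]) (simp add: algebra_simps)
  hence "C x * cos (\<theta> x) + S x * sin (\<theta> x) = C 0 * cos (\<theta> 0) + S 0 * sin (\<theta> 0)"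
    by (intro DERIV_isconst_all[where f = "\<lambda>x. C x * cos (\<theta> x) + S x * sin (\<theta> x)"] allI)
  hence 1: "C x * cos (\<theta> x) + S x * sin (\<theta> x) = 1" using init by simp
  have "((\<lambda>x. S x * cos (\<theta> x) - C x * sin (\<theta> x)) has_real_derivative 0) (at x)" for x
    by (rule DERIV_cong[OF DERIV_diff[OF DERIV_mult[OF S co] DERIV_mult[OF C si]]]) (simp add: algebra_simps)
  hence "S x * cos (\<theta> x) - C x * sin (\<theta> x) = S 0 * cos (\<theta> 0) - C 0 * sin (\<theta> 0)"
    by (intro DERIV_isconst_all[where f = "\<lambda>x. S x * cos (\<theta> x) - C x * sin (\<theta> x)"] allI)
  hence 2: "S x * cos (\<theta> x) - C x * sin (\<theta> x) = 0" using init by simp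
  have 3: "(sin (\<theta> x))\<^sup>2 + (cos (\<theta> x))\<^sup>2 = 1" by simp
  show "cos (\<theta> x) = C x" using 1 2 3 by algebra
  show "sin (\<theta> x) = S x" using 1 2 3 by algebra
qed

text \<open>These two functions of \<open>x/2\<close> rotate with angular velocity \<open>(1 + q) (1 - q s\<^sup>2) / (2 (1 + q s\<^sup>2))\<close>, which by the
  duplication formula is \<open>ring_weight q x\<close>. (This is Gauss's transformation: \<open>ring_phase q x\<close> is the
  amplitude of \<open>(1 + q) x / 2\<close> for the modulus \<open>2 sqrt q / (1 + q)\<close>.)\<close>

lemma
  assumes q: "0 \<le> q" "q \<le> 1"
  defines "s \<equiv> \<lambda>x. jacobi_sn q (x / 2)" and "c \<equiv> \<lambda>x. jacobi_cn q (x / 2)" and "d \<equiv> \<lambda>x. jacobi_dn q (x / 2)"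
  shows cos_ring_phase: "cos (ring_phase q x) = c x * d x / (1 + q * (s x)\<^sup>2)"
    and sin_ring_phase: "sin (ring_phase q x) = (1 + q) * s x / (1 + q * (s x)\<^sup>2)"
proof -
  have half: "((\<lambda>x. x / 2) has_real_derivative 1 / 2) (at x)" for x :: real
    by (auto intro!: derivative_eq_intros)
  have s': "(s has_real_derivative c x * d x * (1 / 2)) (at x)"
   and c': "(c has_real_derivative - (s x * d x) * (1 / 2)) (at x)"
   and d': "(d has_real_derivative - (q\<^sup>2 * s x * c x) * (1 / 2)) (at x)" for x
    unfolding s_def c_def d_def
    by (rule DERIV_chain2[OF DERIV_jacobi_sn[OF q] half] DERIV_chain2[OF DERIV_jacobi_cn[OF q] half]
        DERIV_chain2[OF DERIV_jacobi_dn[OF q] half])+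
  have sq: "(d x)\<^sup>2 = 1 - q\<^sup>2 * (s x)\<^sup>2" "(c x)\<^sup>2 = 1 - (s x)\<^sup>2" for x
    unfolding s_def c_def d_def by (simp_all add: jacobi_dn_square[OF q] jacobi_cn_square)
  define D where "D x = 1 + q * (s x)\<^sup>2" for x
  have D: "D x > 0" for x using q(1) by (auto simp: D_def add_pos_nonneg)
  have D': "(D has_real_derivative 0 + q * (of_nat 2 * (c x * d x * (1 / 2) * s x ^ (2 - Suc 0)))) (at x)" for x
    unfolding D_def[abs_def] by (intro DERIV_add DERIV_const DERIV_cmult DERIV_power s')
  have w: "ring_weight q x = (1 + q) * (1 - q * (s x)\<^sup>2) / (2 * D x)" for x
    using jacobi_dn_cn_half_argument[OF q, of x] by (simp add: ring_weight_def s_def D_def)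
  have C': "((\<lambda>x. c x * d x / D x) has_real_derivative - (ring_weight q x * ((1 + q) * s x / D x))) (at x)" for x
  proof (rule DERIV_cong[OF DERIV_divide[OF DERIV_mult[OF c' d'] D']])
    show "D x \<noteq> 0" using D[of x] by simp
    have "2 * ((- (s x * d x) * (1 / 2) * d x + - (q\<^sup>2 * s x * c x) * (1 / 2) * c x) * D x
        - c x * d x * (0 + q * (of_nat 2 * (c x * d x * (1 / 2) * s x ^ (2 - Suc 0)))))
      = - ((1 + q) * (1 - q * (s x)\<^sup>2) * ((1 + q) * s x))"
      using sq[of x] by (simp add: D_def) algebra
    thus "((- (s x * d x) * (1 / 2) * d x + - (q\<^sup>2 * s x * c x) * (1 / 2) * c x) * D x
        - c x * d x * (0 + q * (of_nat 2 * (c x * d x * (1 / 2) * s x ^ (2 - Suc 0))))) / (D x * D x)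
      = - (ring_weight q x * ((1 + q) * s x / D x))"
      unfolding w using D[of x] by (simp add: divide_simps)
  qed
  have S': "((\<lambda>x. (1 + q) * s x / D x) has_real_derivative ring_weight q x * (c x * d x / D x)) (at x)" for x
  proof (rule DERIV_cong[OF DERIV_divide[OF DERIV_cmult[OF s'] D']])
    show "D x \<noteq> 0" using D[of x] by simp
    have "2 * ((1 + q) * (c x * d x * (1 / 2)) * D x
        - (1 + q) * s x * (0 + q * (of_nat 2 * (c x * d x * (1 / 2) * s x ^ (2 - Suc 0)))))
      = (1 + q) * (1 - q * (s x)\<^sup>2) * (c x * d x)"
      by (simp add: D_def algebra_simps power2_eq_square)
    thus "((1 + q) * (c x * d x * (1 / 2)) * D x
        - (1 + q) * s x * (0 + q * (of_nat 2 * (c x * d x * (1 / 2) * s x ^ (2 - Suc 0))))) / (D x * D x)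
      = ring_weight q x * (c x * d x / D x)"
      unfolding w using D[of x] by (simp add: divide_simps)
  qed
  have init: "c 0 * d 0 / D 0 = 1" "(1 + q) * s 0 / D 0 = 0"
    using q by (simp_all add: s_def c_def d_def D_def)
  note rot = cos_sin_of_rotation[OF C' S' DERIV_ring_phase[OF q] init ring_phase_0]
  show "cos (ring_phase q x) = c x * d x / (1 + q * (s x)\<^sup>2)"
    "sin (ring_phase q x) = (1 + q) * s x / (1 + q * (s x)\<^sup>2)"
    using rot by (simp_all add: D_def)
qed

text \<open>Since \<open>K'(q)\<close> is the quarter period \<open>K\<close> of the complementary modulus \<open>q'\<close>, and \<open>q\<close> is complementary to \<open>q'\<close>,
  the values at the half period are rational in \<open>sqrt q\<close> and \<open>sqrt (1 + q)\<close>.\<close>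

lemma jacobi_sn_complex_middle_line:
  assumes q: "0 < q" "q \<le> 1"
  shows "jacobi_sn_complex q ((of_real x + \<i> * of_real (elliptic_K' q)) / 2)
       = of_real (1 / sqrt q) * cis (pi / 2 - ring_phase q x)"
proof -
  have q0: "0 \<le> q" using q by simp
  define q' where "q' = compl_modulus q"
  have q': "0 \<le> q'" "q' < 1" and q'': "sqrt (1 - q'\<^sup>2) = q"
    using q compl_modulus[OF q0 q(2)] by (auto simp: q'_def compl_modulus_def)
  have K: "elliptic_K' q = elliptic_K q'" by (simp add: elliptic_K'_def q'_def compl_modulus_def)
  define z where "z = (complex_of_real x + \<i> * of_real (elliptic_K' q)) / 2"
  have z: "Re z = x / 2" "Im z = elliptic_K q' / 2" by (simp_all add: z_def K)
  define s c d where defs: "s = jacobi_sn q (x / 2)" "c = jacobi_cn q (x / 2)" "d = jacobi_dn q (x / 2)"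
  note half = jacobi_half_period[OF q', unfolded q'']
  have re: "sn_num_re q z = s * sqrt q"
    by (simp add: sn_num_re_def z half defs flip: q'_def)
  have im: "sn_num_im q z = c * d * sqrt q / (1 + q)"
    using q(1) by (simp add: sn_num_im_def z half defs flip: q'_def)
  have "sn_den q z = q / (1 + q) + q\<^sup>2 * s\<^sup>2 / (1 + q)"
    using q(1) by (simp add: sn_den_def z half defs power_divide flip: q'_def)
  hence den: "sn_den q z = q * (1 + q * s\<^sup>2) / (1 + q)"
    by (simp add: add_divide_distrib[symmetric] power2_eq_square distrib_left mult.assoc)
  have nz: "1 + q * s\<^sup>2 > 0" using q(1) by (intro add_pos_nonneg) auto
  have qq: "sqrt q / q = 1 / sqrt q" using q(1) by (simp add: real_div_sqrt field_simps)
  have "sn_num_re q z / sn_den q z = (sqrt q / q) * ((1 + q) * s / (1 + q * s\<^sup>2))"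
    unfolding re den using nz q(1) by (simp add: field_simps)
  hence 1: "sn_num_re q z / sn_den q z = 1 / sqrt q * sin (ring_phase q x)"
    unfolding qq using sin_ring_phase[OF q0 q(2), of x] by (simp flip: defs)
  have "sn_num_im q z / sn_den q z = (sqrt q / q) * (c * d / (1 + q * s\<^sup>2))"
    unfolding im den using q(1) by (simp add: times_divide_times_eq mult.commute)
  hence 2: "sn_num_im q z / sn_den q z = 1 / sqrt q * cos (ring_phase q x)"
    unfolding qq using cos_ring_phase[OF q0 q(2), of x] by (simp flip: defs)
  show ?thesis
    unfolding z_def[symmetric] jacobi_sn_complex_eq[OF q0 q(2)] sn_ext_def 1 2
    by (simp add: complex_eq_iff sin_diff cos_diff)
qed

text \<open>Two continuous branches of the argument that agree at \<open>0\<close> agree everywhere: a nonzero value of \<open>\<delta>\<close> would have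
  modulus at least \<open>\<pi>\<close>, so \<open>\<bar>\<delta>\<bar>\<close> would take the value \<open>\<pi>\<close> somewhere, but \<open>cos \<pi> = -1\<close>.\<close>

lemma continuous_multiple_of_two_pi_eq_0:
  fixes \<delta> :: "real \<Rightarrow> real"
  assumes cont: "continuous_on UNIV \<delta>" and "\<delta> 0 = 0" and cos: "\<And>x. cos (\<delta> x) = 1"
  shows "\<delta> x = 0"
proof (rule ccontr)
  assume nz: "\<delta> x \<noteq> 0"
  have "\<not> \<bar>\<delta> x\<bar> < pi"
    using cos_monotone_0_pi[of 0 "\<bar>\<delta> x\<bar>"] cos[of x] nz by auto
  moreover have "connected ((\<lambda>x. \<bar>\<delta> x\<bar>) ` UNIV)"
    using cont by (intro connected_continuous_image continuous_intros) auto
  ultimately have "pi \<in> (\<lambda>x. \<bar>\<delta> x\<bar>) ` UNIV"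
    using assms(2) by (intro connectedD_interval[of _ "\<bar>\<delta> 0\<bar>" "\<bar>\<delta> x\<bar>" pi]) auto
  then obtain y where y: "pi = \<bar>\<delta> y\<bar>" by blast
  have "cos (\<delta> y) = -1" using cos_abs_real[of "\<delta> y"] unfolding y[symmetric] by simp
  thus False using cos[of y] by simp
qed

lemma ring_g_eq_ring_phase:
  assumes q: "0 < q" "q \<le> 1"
  shows "ring_g q = ring_phase q"
proof -
  have q0: "0 \<le> q" using q by simp
  define r where "r = 1 / sqrt q"
  have r: "r > 0" using q by (simp add: r_def)
  have sn: "jacobi_sn_complex q ((of_real x + \<i> * of_real (elliptic_K' q)) / 2)
    = of_real r * cis (pi / 2 - ring_phase q x)" for x
    using jacobi_sn_complex_middle_line[OF q] by (simp add: r_def)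
  have arg: "is_Arg (of_real r * cis a) b \<longleftrightarrow> cis a = cis b" for a b
    using r by (simp add: is_Arg_def norm_mult cis_conv_exp)
  have cont: "continuous_on UNIV (ring_phase q)"
    by (rule DERIV_imp_continuous_on[OF DERIV_ring_phase[OF q0 q(2)]])
  show ?thesis unfolding ring_g_def sn arg
  proof (rule the_equality)
    fix g assume g: "continuous_on UNIV g \<and> g 0 = 0 \<and> (\<forall>x. cis (pi / 2 - ring_phase q x) = cis (pi / 2 - g x))"
    have "cos (g x - ring_phase q x) = 1" for x
    proof -
      have "cis (g x - ring_phase q x) = cis (pi / 2 - ring_phase q x) / cis (pi / 2 - g x)"
        by (simp add: cis_divide)
      also have "\<dots> = 1" using g by simp
      finally show ?thesis by (metis cis.sel(1) one_complex.sel(1))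
    qed
    moreover have "continuous_on UNIV (\<lambda>x. g x - ring_phase q x)" "g 0 - ring_phase q 0 = 0"
      using g cont by (auto intro: continuous_on_diff)
    ultimately have "g x - ring_phase q x = 0" for x
      by (rule continuous_multiple_of_two_pi_eq_0[where \<delta> = "\<lambda>x. g x - ring_phase q x", rotated 2])
    thus "g = ring_phase q" by (simp add: fun_eq_iff)
  qed (use cont in auto)
qed

lemma DERIV_ring_g:
  assumes "0 < q" "q \<le> 1"
  shows "(ring_g q has_real_derivative ring_weight q x) (at x)"
  using DERIV_ring_phase[of q x] assms by (simp add: ring_g_eq_ring_phase)

lemma DERIV_ring_F:
  assumes "0 < q" "q \<le> 1"
  shows "(ring_F q has_real_derivative ring_g q x) (at x)"
  unfolding ring_F_def[abs_def]
  by (rule has_real_derivative_integral_from_0[OF DERIV_imp_continuous_on[OF DERIV_ring_g[OF assms]]])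

lemma convex_on_ring_F:
  assumes "0 < q" "q \<le> 1"
  shows "convex_on UNIV (ring_F q)"
  using assms
  by (intro f''_ge0_imp_convex[where f = "ring_F q" and f' = "ring_g q" and f'' = "ring_weight q"]
      DERIV_ring_F DERIV_ring_g ring_weight_nonneg) auto

section \<open>Sums of functions of linear forms\<close>

text \<open>The first derivative of \<open>y \<mapsto> F (L y)\<close> at \<open>y\<close> is the linear form \<open>g (L y) L\<close>, which depends on \<open>y\<close> only through a scalar factor.\<close>

lemma has_second_derivative_ridge:
  fixes L :: "'a::real_normed_vector \<Rightarrow>\<^sub>L real"
  assumes F: "\<And>t. (F has_real_derivative g t) (at t)" and g: "\<And>t. (g has_real_derivative w t) (at t)"
  shows "has_second_derivative (\<lambda>y. F (blinfun_apply L y))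
           (\<lambda>h. (blinfun_apply L h * w (blinfun_apply L x)) *\<^sub>R L) x"
  unfolding has_second_derivative_def
proof (intro exI conjI always_eventually allI)
  fix y
  have "((\<lambda>y. F (blinfun_apply L y)) has_derivative (\<lambda>h. blinfun_apply L h * g (blinfun_apply L y))) (at y)"
    by (rule DERIV_compose_FDERIV[OF F bounded_linear.has_derivative[OF blinfun.bounded_linear_right has_derivative_ident]])
  thus "((\<lambda>y. F (blinfun_apply L y)) has_derivative blinfun_apply (g (blinfun_apply L y) *\<^sub>R L)) (at y)"
    by (rule has_derivative_eq_rhs) (simp add: fun_eq_iff scaleR_blinfun.rep_eq mult.commute)
next
  show "((\<lambda>y. g (blinfun_apply L y) *\<^sub>R L) has_derivative
      (\<lambda>h. (blinfun_apply L h * w (blinfun_apply L x)) *\<^sub>R L)) (at x)"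
    by (intro has_derivative_scaleR_left
        DERIV_compose_FDERIV[OF g bounded_linear.has_derivative[OF blinfun.bounded_linear_right has_derivative_ident]])
qed

lemma has_second_derivative_linear:
  assumes "bounded_linear f"
  shows "has_second_derivative f (\<lambda>h. 0) x"
  unfolding has_second_derivative_def
proof (intro exI conjI always_eventually allI)
  show "(f has_derivative blinfun_apply (Blinfun f)) (at y)" for y
    unfolding bounded_linear_Blinfun_apply[OF assms] by (rule bounded_linear_imp_has_derivative[OF assms])
qed (rule has_derivative_const)

lemma has_second_derivative_add:
  assumes "has_second_derivative f D x" "has_second_derivative g E x"
  shows "has_second_derivative (\<lambda>y. f y + g y) (\<lambda>h. D h + E h) x"
proof -
  obtain f' where f: "\<forall>\<^sub>F y in nhds x. (f has_derivative blinfun_apply (f' y)) (at y)" "(f' has_derivative D) (at x)"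
    using assms(1) unfolding has_second_derivative_def by blast
  obtain g' where g: "\<forall>\<^sub>F y in nhds x. (g has_derivative blinfun_apply (g' y)) (at y)" "(g' has_derivative E) (at x)"
    using assms(2) unfolding has_second_derivative_def by blast
  show ?thesis unfolding has_second_derivative_def
  proof (intro exI conjI)
    show "\<forall>\<^sub>F y in nhds x. ((\<lambda>y. f y + g y) has_derivative blinfun_apply (f' y + g' y)) (at y)"
      using f(1) g(1)
    proof eventually_elim
      case (elim y)
      show ?case
        by (rule has_derivative_eq_rhs[OF has_derivative_add[OF elim]]) (simp add: fun_eq_iff plus_blinfun.rep_eq)
    qed
    show "((\<lambda>y. f' y + g' y) has_derivative (\<lambda>h. D h + E h)) (at x)"
      by (rule has_derivative_add[OF f(2) g(2)])
  qed
qed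

lemma has_second_derivative_sum:
  assumes "finite I" "\<And>i. i \<in> I \<Longrightarrow> has_second_derivative (f i) (D i) x"
  shows "has_second_derivative (\<lambda>y. \<Sum>i\<in>I. f i y) (\<lambda>h. \<Sum>i\<in>I. D i h) x"
  using assms
proof (induction I rule: finite_induct)
  case empty
  show ?case using has_second_derivative_linear[OF bounded_linear_zero] by simp
next
  case (insert i I)
  thus ?case using has_second_derivative_add[of "f i" "D i" x] by simp
qed

lemma convex_on_linear:
  assumes "linear f"
  shows "convex_on UNIV (f :: 'a::real_vector \<Rightarrow> real)"
  by (simp add: convex_on_def linear_add[OF assms] linear_scale[OF assms])

lemma convex_on_compose_linear:
  assumes "linear L" "convex_on UNIV F"
  shows "convex_on UNIV (\<lambda>y. F (L y))"
  using assms(2) by (simp add: convex_on_def linear_add[OF assms(1)] linear_scale[OF assms(1)])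

lemma convex_on_finite_sum:
  assumes "finite I" "convex S" "\<And>i. i \<in> I \<Longrightarrow> convex_on S (f i)"
  shows "convex_on S (\<lambda>y. \<Sum>i\<in>I. f i y)"
  using assms(1,3)
proof (induction I rule: finite_induct)
  case empty
  show ?case using assms(2) by (simp add: convex_on_def)
next
  case (insert i I)
  thus ?case using convex_on_add[of S "f i"] by simp
qed

section \<open>The hyperbolic functional\<close>

theorem theorem5p3:
  fixes q :: real
    and Q :: "(int \<times> int) set"
    and pos :: "'v::finite \<Rightarrow> int \<times> int"
    and \<Phi> :: "'v \<Rightarrow> real"
  assumes "0 < q" and "q \<le> 1"
    and "simply_connected_square_complex Q"
    and "bij_betw pos UNIV (even_vertices Q)"
  shows "convex_on UNIV (S_hyp q pos \<Phi>) \<and>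
    (\<forall>\<gamma>. \<exists>D. has_second_derivative (S_hyp q pos \<Phi>) D \<gamma> \<and>
      (\<forall>d. blinfun_apply (D d) d =
        1 / 2 * (\<Sum>(j, k)\<in>ring_edges pos.
          (jacobi_dn q (\<gamma> $ j - \<gamma> $ k) + q * jacobi_cn q (\<gamma> $ j - \<gamma> $ k)) * (d $ j - d $ k)\<^sup>2
        + (jacobi_dn q (\<gamma> $ j + \<gamma> $ k) + q * jacobi_cn q (\<gamma> $ j + \<gamma> $ k)) * (d $ j + d $ k)\<^sup>2)))"
proof -
  define diff :: "'v \<times> 'v \<Rightarrow> (real ^ 'v) \<Rightarrow>\<^sub>L real" where "diff e = Blinfun (\<lambda>\<gamma> :: real ^ 'v. \<gamma> $ fst e - \<gamma> $ snd e)" for e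
  define total :: "'v \<times> 'v \<Rightarrow> (real ^ 'v) \<Rightarrow>\<^sub>L real" where "total e = Blinfun (\<lambda>\<gamma> :: real ^ 'v. \<gamma> $ fst e + \<gamma> $ snd e)" for e
  have diff: "blinfun_apply (diff e) = (\<lambda>\<gamma> :: real ^ 'v. \<gamma> $ fst e - \<gamma> $ snd e)" for e
    unfolding diff_def by (intro bounded_linear_Blinfun_apply bounded_linear_sub bounded_linear_vec_nth)
  have total: "blinfun_apply (total e) = (\<lambda>\<gamma> :: real ^ 'v. \<gamma> $ fst e + \<gamma> $ snd e)" for e
    unfolding total_def by (intro bounded_linear_Blinfun_apply bounded_linear_add bounded_linear_vec_nth)
  define \<Lambda> :: "real ^ 'v \<Rightarrow> real" where "\<Lambda> \<gamma> = (\<Sum>j\<in>UNIV. \<Phi> j * \<gamma> $ j)" for \<gamma>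
  have Lambda: "bounded_linear \<Lambda>"
    unfolding \<Lambda>_def[abs_def] by (intro bounded_linear_sum bounded_linear_const_mult bounded_linear_vec_nth)
  have S: "S_hyp q pos \<Phi> = (\<lambda>\<gamma>. (\<Sum>e\<in>ring_edges pos.
      ring_F q (blinfun_apply (diff e) \<gamma>) + ring_F q (blinfun_apply (total e) \<gamma>)) + \<Lambda> \<gamma>)"
    by (simp add: fun_eq_iff S_hyp_def diff total \<Lambda>_def case_prod_unfold)
  have lin: "linear (blinfun_apply (L :: (real ^ 'v) \<Rightarrow>\<^sub>L real))" for L
    by (rule bounded_linear.linear[OF blinfun.bounded_linear_right])
  have "convex_on UNIV (S_hyp q pos \<Phi>)"
    unfolding S
  proof (rule convex_on_add)
    show "convex_on UNIV \<Lambda>" by (rule convex_on_linear[OF bounded_linear.linear[OF Lambda]])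
    show "convex_on UNIV (\<lambda>\<gamma>. \<Sum>e\<in>ring_edges pos.
        ring_F q (blinfun_apply (diff e) \<gamma>) + ring_F q (blinfun_apply (total e) \<gamma>))"
    proof (rule convex_on_finite_sum)
      show "convex_on UNIV (\<lambda>\<gamma>. ring_F q (blinfun_apply (diff e) \<gamma>) + ring_F q (blinfun_apply (total e) \<gamma>))" for e
        by (rule convex_on_add; rule convex_on_compose_linear[OF lin convex_on_ring_F[OF assms(1,2)]])
    qed simp_all
  qed
  moreover have "\<exists>D. has_second_derivative (S_hyp q pos \<Phi>) D \<gamma> \<and>
      (\<forall>d. blinfun_apply (D d) d =
        1 / 2 * (\<Sum>(j, k)\<in>ring_edges pos.
          (jacobi_dn q (\<gamma> $ j - \<gamma> $ k) + q * jacobi_cn q (\<gamma> $ j - \<gamma> $ k)) * (d $ j - d $ k)\<^sup>2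
        + (jacobi_dn q (\<gamma> $ j + \<gamma> $ k) + q * jacobi_cn q (\<gamma> $ j + \<gamma> $ k)) * (d $ j + d $ k)\<^sup>2))" for \<gamma>
  proof -
    define H where "H e h =
        (blinfun_apply (diff e) h * ring_weight q (blinfun_apply (diff e) \<gamma>)) *\<^sub>R diff e
      + (blinfun_apply (total e) h * ring_weight q (blinfun_apply (total e) \<gamma>)) *\<^sub>R total e" for e h
    \<comment> \<open>The summand \<open>0\<close> comes from the linear part \<open>\<Lambda>\<close>.\<close>
    define D where "D h = (\<Sum>e\<in>ring_edges pos. H e h) + 0" for h
    note ridge = has_second_derivative_ridge[OF DERIV_ring_F[OF assms(1,2)] DERIV_ring_g[OF assms(1,2)]]
    have "has_second_derivative
        (\<lambda>\<gamma>. ring_F q (blinfun_apply (diff e) \<gamma>) + ring_F q (blinfun_apply (total e) \<gamma>)) (H e) \<gamma>" for e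
      unfolding H_def[abs_def] by (rule has_second_derivative_add[OF ridge ridge])
    from has_second_derivative_add[OF has_second_derivative_sum[OF finite this] has_second_derivative_linear[OF Lambda]]
    have deriv: "has_second_derivative (S_hyp q pos \<Phi>) D \<gamma>"
      unfolding S D_def[abs_def] .
    have half: "(a * ring_weight q b) * a = 1 / 2 * ((jacobi_dn q b + q * jacobi_cn q b) * a\<^sup>2)" for a b
      by (simp add: ring_weight_def power2_eq_square)
    have H: "blinfun_apply (H (j, k) d) d =
        1 / 2 * ((jacobi_dn q (\<gamma> $ j - \<gamma> $ k) + q * jacobi_cn q (\<gamma> $ j - \<gamma> $ k)) * (d $ j - d $ k)\<^sup>2
        + (jacobi_dn q (\<gamma> $ j + \<gamma> $ k) + q * jacobi_cn q (\<gamma> $ j + \<gamma> $ k)) * (d $ j + d $ k)\<^sup>2)" for j k d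
      by (simp only: H_def blinfun.add_left blinfun.scaleR_left diff total real_scaleR_def fst_conv snd_conv
          half distrib_left[of "1 / 2"])
    have "blinfun_apply (D d) d = (\<Sum>(j, k)\<in>ring_edges pos. blinfun_apply (H (j, k) d) d)" for d
      by (simp add: D_def blinfun.sum_left case_prod_unfold)
    hence form: "blinfun_apply (D d) d =
        1 / 2 * (\<Sum>(j, k)\<in>ring_edges pos.
          (jacobi_dn q (\<gamma> $ j - \<gamma> $ k) + q * jacobi_cn q (\<gamma> $ j - \<gamma> $ k)) * (d $ j - d $ k)\<^sup>2
        + (jacobi_dn q (\<gamma> $ j + \<gamma> $ k) + q * jacobi_cn q (\<gamma> $ j + \<gamma> $ k)) * (d $ j + d $ k)\<^sup>2)" for d
      unfolding H sum_distrib_left by (simp only: case_prod_unfold)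
    show ?thesis by (intro exI[of _ D] conjI allI deriv form)
  qed
  ultimately show ?thesis by (intro conjI allI)
qed

end
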